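(* The inverse monoid $\mathrm{FPT}$ is residually finite: for all distinct $u,v\in\mathrm{FPT}$ there exist a finite monoid $N$ and a monoid homomorphism $\alpha:\mathrm{FPT}\to N$ with $\alpha(u)\neq\alpha(v)$.
   Context: A tree is a nonempty prefix-closed set $A\subseteq(\mathbb N^+)^*$ with $wj\in A$, $i<j$ implying $wi\in A$. A permutation tree is a map $t:A\to\mathrm{Sym}(\mathbb N^+)$ such that a node with exactly $n$ children has label in $S_n$ (permutations of $\mathbb N^+$ fixing all $i>n$). Write $t=\langle\pi;t_1,..,t_n\rangle$; $\bar\epsilon$ is the one-node tree. $\mathrm{FPT}$ is the set of finite permutation trees, with product: $t\bar\epsilon=t=\bar\epsilon t$; for $t=\langle\pi;t_1..t_n\rangle$, $u=\langle\rho;u_1..u_m\rangle$: if $n\ge m$, $tu=\langle\pi\circ\rho;u_1t_{\rho1},..,u_mt_{\rho m},t_{m+1},..,t_n\rangle$; if $m\ge n$, $tu=\langle\pi\circ\rho;u_1t_{\rho1},..,u_mt_{\rho m}\rangle$ with $t_j:=\bar\epsilon$ for $j>n$; and $\bar\epsilon^*=\bar\epsilon$, $t^*=\langle\pi^{-1};(t_{\pi^{-1}1})^*,..,(t_{\pi^{-1}n})^*\rangle$. *)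

theory Defs
  imports "HOL-Algebra.Group" "HOL-Combinatorics.Permutations"
begin

text \<open>
  The positive integers are the elements of \<^term>\<open>{1::nat..}\<close>, and a permutation of them is a
  function on \<^typ>\<open>nat\<close> that in addition fixes 0. Thus the symmetric group on the positive integers
  is \<open>{\<pi>. \<pi> permutes {1..}}\<close>, and its subgroup of permutations fixing all \<open>i > n\<close> is
  \<open>{\<pi>. \<pi> permutes {1..n}}\<close>.
\<close>

definition is_tree :: "nat list set \<Rightarrow> bool" where
  "is_tree A \<longleftrightarrow>
     A \<noteq> {} \<and>
     A \<subseteq> lists {1..} \<and>
     (\<forall>v w. v @ w \<in> A \<longrightarrow> v \<in> A) \<and>
     (\<forall>w i j. w @ [j] \<in> A \<and> 1 \<le> i \<and> i < j \<longrightarrow> w @ [i] \<in> A)"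

text \<open>A map from a tree to permutations is a partial function whose domain is the tree.\<close>

type_synonym ptree = "nat list \<Rightarrow> (nat \<Rightarrow> nat) option"

definition child_set :: "ptree \<Rightarrow> nat list \<Rightarrow> nat set" where
  "child_set t w = {i. w @ [i] \<in> dom t}"

definition perm_tree :: "ptree \<Rightarrow> bool" where
  "perm_tree t \<longleftrightarrow>
     is_tree (dom t) \<and>
     (\<forall>w \<pi>. t w = Some \<pi> \<longrightarrow> \<pi> permutes {1..}) \<and>
     (\<forall>w \<pi>. t w = Some \<pi> \<and> finite (child_set t w) \<longrightarrow>
        \<pi> permutes {1..card (child_set t w)})"

text \<open>
  In \<open>t = \<langle>\<pi>; t\<^sub>1, \<dots>, t\<^sub>n\<rangle>\<close>, \<open>\<pi>\<close> is \<open>root_label t\<close>, \<open>n\<close> is \<open>arity t\<close>, and \<open>t\<^sub>i\<close> is \<open>subtree t i\<close>,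
  which by convention is the one-node tree for \<open>i > n\<close>. The arity is meaningful only if the root
  has finitely many children.
\<close>

definition one_node :: ptree where
  "one_node = [[] \<mapsto> id]"

definition root_label :: "ptree \<Rightarrow> nat \<Rightarrow> nat" where
  "root_label t = the (t [])"

definition arity :: "ptree \<Rightarrow> nat" where
  "arity t = card (child_set t [])"

definition subtree :: "ptree \<Rightarrow> nat \<Rightarrow> ptree" where
  "subtree t i = (if 1 \<le> i \<and> i \<le> arity t then (\<lambda>w. t (i # w)) else one_node)"

text \<open>
  The product \<open>tu\<close> of \<open>t = \<langle>\<pi>; t\<^sub>1, \<dots>, t\<^sub>n\<rangle>\<close> and \<open>u = \<langle>\<rho>; u\<^sub>1, \<dots>, u\<^sub>m\<rangle>\<close> has root label \<open>\<pi> \<circ> \<rho>\<close> and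
  subtrees \<open>u\<^sub>i t\<^bsub>\<rho> i\<^esub>\<close> for \<open>i \<le> m\<close>, followed by \<open>t\<^sub>i\<close> for \<open>m < i \<le> n\<close> (none if \<open>m \<ge> n\<close>). The
  label at a word is computed by recursion on the word; the two factors trade places at each
  level. If one factor is the one-node tree, the same
  equations give the other one.
\<close>

fun pt_mult :: "ptree \<Rightarrow> ptree \<Rightarrow> ptree" where
  "pt_mult t u [] = Some (root_label t \<circ> root_label u)"
| "pt_mult t u (i # w) =
     (if 1 \<le> i \<and> i \<le> arity u then pt_mult (subtree u i) (subtree t (root_label u i)) w
      else if arity u < i \<and> i \<le> arity t then subtree t i w
      else None)"

fun pt_star :: "ptree \<Rightarrow> ptree" where
  "pt_star t [] = Some (inv_into UNIV (root_label t))"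
| "pt_star t (i # w) =
     (if 1 \<le> i \<and> i \<le> arity t then pt_star (subtree t (inv_into UNIV (root_label t) i)) w
      else None)"

definition FPT :: "ptree monoid" where
  "FPT = \<lparr>carrier = {t. perm_tree t \<and> finite (dom t)}, monoid.mult = pt_mult, one = one_node\<rparr>"

definition inverse_monoid :: "('a, 'b) monoid_scheme \<Rightarrow> ('a \<Rightarrow> 'a) \<Rightarrow> bool" where
  "inverse_monoid M star \<longleftrightarrow>
     monoid M \<and>
     (\<forall>x \<in> carrier M.
        star x \<in> carrier M \<and>
        x \<otimes>\<^bsub>M\<^esub> star x \<otimes>\<^bsub>M\<^esub> x = x \<and>
        star x \<otimes>\<^bsub>M\<^esub> x \<otimes>\<^bsub>M\<^esub> star x = star x \<and>
        (\<forall>y \<in> carrier M. x \<otimes>\<^bsub>M\<^esub> y \<otimes>\<^bsub>M\<^esub> x = x \<and> y \<otimes>\<^bsub>M\<^esub> x \<otimes>\<^bsub>M\<^esub> y = y \<longrightarrow> y = star x))"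

definition monoid_hom :: "('a, 'b) monoid_scheme \<Rightarrow> ('c, 'd) monoid_scheme \<Rightarrow> ('a \<Rightarrow> 'c) set" where
  "monoid_hom M N = {\<alpha> \<in> hom M N. \<alpha> \<one>\<^bsub>M\<^esub> = \<one>\<^bsub>N\<^esub>}"

text \<open>
  Every finite monoid is isomorphic to one whose carrier is a set of natural numbers, so
  letting \<open>N\<close> range over the latter loses no generality.
\<close>

definition residually_finite :: "('a, 'b) monoid_scheme \<Rightarrow> bool" where
  "residually_finite M \<longleftrightarrow>
     (\<forall>u \<in> carrier M. \<forall>v \<in> carrier M. u \<noteq> v \<longrightarrow>
        (\<exists>(N :: nat monoid) \<alpha>. monoid N \<and> finite (carrier N) \<and>
           \<alpha> \<in> monoid_hom M N \<and> \<alpha> u \<noteq> \<alpha> v))"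

end

theory Submission
  imports Defs "HOL-Library.Countable_Set"
begin

text \<open>
  Extending children by one-node trees, \<open>(tu)\<^sub>i = u\<^sub>i t\<^bsub>\<rho> i\<^esub>\<close> holds for every \<open>i\<close>, so the inverse monoid
  identities follow by bisimulation from the corresponding identities of permutations and of arities
  (which multiply by taking maxima). For residual finiteness, the trees that have a node outside
  the words of length at most \<open>n\<close> over \<open>{..n}\<close> form an ideal, since a product has at least the depth
  and the arities of each factor. This ideal has a finite complement, so its Rees quotient is finite, and
  it separates \<open>u\<close> from \<open>v\<close> when \<open>n\<close> is large.
\<close>

section \<open>Finite permutation trees\<close>

abbreviation fpt :: "ptree \<Rightarrow> bool" where
  "fpt t \<equiv> perm_tree t \<and> finite (dom t)"

text \<open>The term \<open>\<langle>\<pi>; s 1, ..., s n\<rangle>\<close> as a partial function;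
  values of \<open>s\<close> outside \<open>{1..n}\<close> are never consulted.\<close>

definition node :: "(nat \<Rightarrow> nat) \<Rightarrow> nat \<Rightarrow> (nat \<Rightarrow> ptree) \<Rightarrow> ptree" where
  "node \<pi> n s = (\<lambda>w. case w of [] \<Rightarrow> Some \<pi> | i # v \<Rightarrow> if 1 \<le> i \<and> i \<le> n then s i v else None)"

lemma node_simps [simp]:
  "node \<pi> n s [] = Some \<pi>"
  "node \<pi> n s (i # w) = (if 1 \<le> i \<and> i \<le> n then s i w else None)"
  by (auto simp: node_def)

lemma node_cong:
  assumes "\<And>i. 1 \<le> i \<Longrightarrow> i \<le> n \<Longrightarrow> s i = s' i"
  shows "node \<pi> n s = node \<pi> n s'"
  using assms by (auto simp: node_def fun_eq_iff split: list.split)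

text \<open>Trades the recursion on words for a description by root and subtrees, so that facts on
  \<open>node\<close> apply to products.\<close>

lemma pt_mult_eq_node:
  "pt_mult t u = node (root_label t \<circ> root_label u) (max (arity t) (arity u))
     (\<lambda>i. if i \<le> arity u then pt_mult (subtree u i) (subtree t (root_label u i)) else subtree t i)"
proof
  fix w show "pt_mult t u w = node (root_label t \<circ> root_label u) (max (arity t) (arity u))
     (\<lambda>i. if i \<le> arity u then pt_mult (subtree u i) (subtree t (root_label u i)) else subtree t i) w"
    by (cases w) auto
qed

lemma pt_star_eq_node:
  "pt_star t = node (inv_into UNIV (root_label t)) (arity t) (\<lambda>i. pt_star (subtree t (inv_into UNIV (root_label t) i)))"
proof
  fix w show "pt_star t w = node (inv_into UNIV (root_label t)) (arity t)
     (\<lambda>i. pt_star (subtree t (inv_into UNIV (root_label t) i))) w"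
    by (cases w) auto
qed

section \<open>Decomposition of a finite tree into root label and subtrees\<close>

lemma perm_tree_Nil: "perm_tree t \<Longrightarrow> [] \<in> dom t"
  unfolding perm_tree_def is_tree_def by (metis append_Nil ex_in_conv)

lemma perm_tree_prefix: "perm_tree t \<Longrightarrow> v @ w \<in> dom t \<Longrightarrow> v \<in> dom t"
  unfolding perm_tree_def is_tree_def by blast

lemma perm_tree_sibling:
  "perm_tree t \<Longrightarrow> w @ [j] \<in> dom t \<Longrightarrow> 1 \<le> i \<Longrightarrow> i \<le> j \<Longrightarrow> w @ [i] \<in> dom t"
  unfolding perm_tree_def is_tree_def by (metis le_neq_implies_less)

text \<open>Children inject into the finite domain, and closure under smaller siblings fills every
  gap below the maximal child. Hence the arity is the largest child index, and the label condition
  of \<open>perm_tree\<close> for finite child sets applies at every node.\<close>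

lemma fpt_child_set:
  assumes "fpt t"
  shows "child_set t w = {1..card (child_set t w)}" and "finite (child_set t w)"
proof -
  have inj: "inj_on (\<lambda>i. w @ [i]) (child_set t w)" by (auto simp: inj_on_def)
  have "(\<lambda>i. w @ [i]) ` child_set t w \<subseteq> dom t" by (auto simp: child_set_def)
  then show fin: "finite (child_set t w)"
    using assms inj finite_imageD finite_subset by blast
  have pos: "1 \<le> i" if "i \<in> child_set t w" for i
  proof -
    have "w @ [i] \<in> lists {1..}"
      using that assms unfolding perm_tree_def is_tree_def child_set_def by blast
    then show ?thesis by auto
  qed
  have down: "i \<in> child_set t w" if "j \<in> child_set t w" "1 \<le> i" "i \<le> j" for i j
    using that perm_tree_sibling[of t w j i] assms by (auto simp: child_set_def)
  show "child_set t w = {1..card (child_set t w)}"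
  proof (cases "child_set t w = {}")
    case False
    define m where "m = Max (child_set t w)"
    have "child_set t w = {1..m}"
    proof
      show "child_set t w \<subseteq> {1..m}" using pos fin by (auto simp: m_def)
      show "{1..m} \<subseteq> child_set t w" using down Max_in[OF fin False] by (auto simp: m_def)
    qed
    then show ?thesis by simp
  qed simp
qed

lemma arity_iff: "fpt t \<Longrightarrow> [i] \<in> dom t \<longleftrightarrow> 1 \<le> i \<and> i \<le> arity t"
proof -
  assume "fpt t"
  then have "child_set t [] = {1..arity t}" using fpt_child_set(1) unfolding arity_def by blast
  then have "i \<in> child_set t [] \<longleftrightarrow> 1 \<le> i \<and> i \<le> arity t" by simp
  then show ?thesis by (simp add: child_set_def)
qed

lemma root_label_permutes: "fpt t \<Longrightarrow> root_label t permutes {1..arity t}"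
proof -
  assume t: "fpt t"
  then obtain \<pi> where "t [] = Some \<pi>" using perm_tree_Nil by blast
  moreover have "finite (child_set t [])" using t by (rule fpt_child_set(2))
  ultimately show ?thesis
    using t unfolding perm_tree_def by (simp add: root_label_def arity_def)
qed

text \<open>By prefix closure, a word \<open>i # v\<close> in the domain would force
  \<open>[i]\<close> to be a child of the root, so nothing lies below indices outside
  \<open>{1..arity t}\<close>.\<close>

lemma fpt_eq_node:
  assumes "fpt t" shows "t = node (root_label t) (arity t) (subtree t)"
proof
  fix w show "t w = node (root_label t) (arity t) (subtree t) w"
  proof (cases w)
    case Nil
    then show ?thesis using perm_tree_Nil[of t] assms by (auto simp: root_label_def)
  next
    case (Cons i v)
    have "t w = None" if "\<not> (1 \<le> i \<and> i \<le> arity t)"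
      using that arity_iff[OF assms, of i] perm_tree_prefix[of t "[i]" v] assms Cons by auto
    then show ?thesis by (cases "1 \<le> i \<and> i \<le> arity t") (simp_all add: Cons subtree_def)
  qed
qed

section \<open>Closure of finite trees under grafting and under taking subtrees\<close>

lemma child_set_node_Nil:
  assumes "\<And>i. 1 \<le> i \<Longrightarrow> i \<le> n \<Longrightarrow> fpt (s i)"
  shows "child_set (node \<pi> n s) [] = {1..n}"
proof -
  \<comment> \<open>The word \<open>[i]\<close> lies in the domain of the assembled tree exactly
    because \<open>s i\<close> has a root.\<close>
  have "[] \<in> dom (s i)" if "1 \<le> i" "i \<le> n" for i
    using assms[OF that] by (simp only: perm_tree_Nil)
  then have "[i] \<in> dom (node \<pi> n s) \<longleftrightarrow> i \<in> {1..n}" for i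
    by (cases "1 \<le> i \<and> i \<le> n") (simp_all add: domIff)
  then show ?thesis by (simp add: child_set_def set_eq_iff)
qed

lemma arity_node:
  assumes "\<And>i. 1 \<le> i \<Longrightarrow> i \<le> n \<Longrightarrow> fpt (s i)"
  shows "arity (node \<pi> n s) = n"
  using child_set_node_Nil[OF assms] by (simp add: arity_def)

lemma root_label_node [simp]: "root_label (node \<pi> n s) = \<pi>"
  by (simp add: root_label_def)

lemma subtree_node:
  assumes "\<And>i. 1 \<le> i \<Longrightarrow> i \<le> n \<Longrightarrow> fpt (s i)"
  shows "subtree (node \<pi> n s) i = (if 1 \<le> i \<and> i \<le> n then s i else one_node)"
  using arity_node[OF assms] by (auto simp: subtree_def)

lemma dom_node:
  "dom (node \<pi> n s) = insert [] (\<Union>i\<in>{1..n}. (#) i ` dom (s i))"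
proof (rule Set.set_eqI)
  fix w show "w \<in> dom (node \<pi> n s) \<longleftrightarrow> w \<in> insert [] (\<Union>i\<in>{1..n}. (#) i ` dom (s i))"
    by (cases w) (auto simp: image_iff domIff split: if_splits)
qed

text \<open>Below the root, nodes, labels and child sets are copied from the \<open>s i\<close>, so
  all conditions are inherited; only the root is new, with child set \<open>{1..n}\<close> and label
  in \<open>S_n\<close>.\<close>

lemma fpt_node:
  assumes \<pi>: "\<pi> permutes {1..n}" and s: "\<And>i. 1 \<le> i \<Longrightarrow> i \<le> n \<Longrightarrow> fpt (s i)"
  shows "fpt (node \<pi> n s)"
proof
  let ?t = "node \<pi> n s"
  have child: "child_set ?t (i # w) = child_set (s i) w" if "1 \<le> i" "i \<le> n" for i w
    using that by (auto simp: child_set_def)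
  have root: "child_set ?t [] = {1..n}"
    using child_set_node_Nil s by blast
  have "is_tree (dom ?t)"
    unfolding is_tree_def
  proof (intro conjI allI impI subsetI)
    show "dom ?t \<noteq> {}" by (simp add: dom_node)
  next
    fix w assume w: "w \<in> dom ?t"
    have "v \<in> lists {1..}" if "1 \<le> i" "i \<le> n" "v \<in> dom (s i)" for i v
      using s[OF that(1,2)] that(3) unfolding perm_tree_def is_tree_def by blast
    then show "w \<in> lists {1..}"
      using w unfolding dom_node by (elim insertE UN_E imageE) (simp, simp, blast)
  next
    fix v w assume "v @ w \<in> dom ?t"
    then show "v \<in> dom ?t"
      using perm_tree_prefix s by (cases v) (auto split: if_splits, blast+)
  next
    fix w i j assume *: "w @ [j] \<in> dom ?t \<and> 1 \<le> i \<and> i < j"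
    show "w @ [i] \<in> dom ?t"
    proof (cases w)
      case Nil
      then show ?thesis using * root by (auto simp: child_set_def split: if_splits)
    next
      case (Cons k v)
      then have k: "1 \<le> k" "k \<le> n" "v @ [j] \<in> dom (s k)" using * by (auto split: if_splits)
      then have "v @ [i] \<in> dom (s k)"
        using perm_tree_sibling[of "s k" v j i] s[of k] * by auto
      then show ?thesis using Cons k by auto
    qed
  qed
  moreover have "\<rho> permutes {1..}" if "?t w = Some \<rho>" for w \<rho>
  proof (cases w)
    case Nil
    then show ?thesis using that permutes_subset[OF \<pi>, of "{1..}"] by auto
  next
    case (Cons i v)
    then show ?thesis using that s[of i] unfolding perm_tree_def by (auto split: if_splits)
  qed
  moreover have "\<rho> permutes {1..card (child_set ?t w)}"
    if "?t w = Some \<rho>" "finite (child_set ?t w)" for w \<rho>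
  proof (cases w)
    case Nil
    then show ?thesis using that \<pi> root by auto
  next
    case (Cons i v)
    then have "1 \<le> i" "i \<le> n" "s i v = Some \<rho>" using that by (auto split: if_splits)
    then show ?thesis using that Cons child s[of i] unfolding perm_tree_def by auto
  qed
  ultimately show "perm_tree ?t" unfolding perm_tree_def by blast
  show "finite (dom ?t)" using s by (auto simp: dom_node)
qed

text \<open>With no children the family \<open>s\<close> is arbitrary. The one-node tree thereby
  becomes an instance of the facts on \<open>node\<close>; later uses pick \<open>undefined\<close>
  for \<open>s\<close>.\<close>

lemma one_node_eq_node: "one_node = node id 0 s"
  by (auto simp: one_node_def node_def fun_eq_iff split: list.split)

lemma fpt_one_node: "fpt one_node"
  unfolding one_node_eq_node[of undefined] by (rule fpt_node) (auto simp: permutes_id)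

lemma root_label_one_node [simp]: "root_label one_node = id"
  by (simp add: one_node_eq_node[of undefined])

lemma arity_one_node [simp]: "arity one_node = 0"
  unfolding one_node_eq_node[of undefined] by (rule arity_node) auto

lemma subtree_one_node [simp]: "subtree one_node i = one_node"
  unfolding subtree_def by (rule if_not_P) simp

lemma subtree_outside: "\<not> (1 \<le> i \<and> i \<le> arity t) \<Longrightarrow> subtree t i = one_node"
  unfolding subtree_def by (rule if_not_P)

text \<open>For a genuine child, each condition at \<open>w\<close> in the subtree is the condition
  on \<open>t\<close> at \<open>i # w\<close>. Padding is covered as well, so no index condition is
  needed when descending.\<close>

lemma fpt_subtree:
  assumes "fpt t" shows "fpt (subtree t i)"
proof (cases "1 \<le> i \<and> i \<le> arity t")
  case False
  then show ?thesis using fpt_one_node by (simp add: subtree_outside)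
next
  case True
  then have sub: "subtree t i = (\<lambda>w. t (i # w))" by (simp add: subtree_def)
  have dom: "w \<in> dom (subtree t i) \<longleftrightarrow> i # w \<in> dom t" for w by (auto simp: sub)
  have child: "child_set (subtree t i) w = child_set t (i # w)" for w
    by (auto simp: child_set_def sub)
  have "is_tree (dom (subtree t i))"
    unfolding is_tree_def
  proof (intro conjI allI impI subsetI)
    show "dom (subtree t i) \<noteq> {}" using True arity_iff[OF assms] dom by blast
  next
    fix w assume "w \<in> dom (subtree t i)"
    then have "i # w \<in> dom t" by (simp only: dom)
    then have "i # w \<in> lists {1..}"
      using assms unfolding perm_tree_def is_tree_def by blast
    then show "w \<in> lists {1..}" by auto
  next
    fix v w assume "v @ w \<in> dom (subtree t i)"
    then show "v \<in> dom (subtree t i)"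
      using perm_tree_prefix[of t "i # v" w] assms dom by auto
  next
    fix w k j assume "w @ [j] \<in> dom (subtree t i) \<and> 1 \<le> k \<and> k < j"
    then show "w @ [k] \<in> dom (subtree t i)"
      using perm_tree_sibling[of t "i # w" j k] assms dom by auto
  qed
  then have "perm_tree (subtree t i)"
    using assms child unfolding perm_tree_def sub by auto
  moreover have "dom (subtree t i) = (#) i -` dom t" by (auto simp: sub)
  then have "finite (dom (subtree t i))"
    using assms by (simp add: finite_vimageI)
  ultimately show ?thesis by blast
qed

section \<open>Size of trees and bisimulation\<close>

lemma card_dom_pos: "fpt t \<Longrightarrow> 0 < card (dom t)"
  using perm_tree_Nil by (auto simp: card_gt_0_iff)

text \<open>The domain of \<open>t\<close> contains a copy of that of the subtree together with the
  root, which is not in the copy. This is the decrease used to show that products and stars are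
  finite trees.\<close>

lemma card_dom_subtree_less:
  assumes t: "fpt t" and i: "1 \<le> i" "i \<le> arity t"
  shows "card (dom (subtree t i)) < card (dom t)"
proof -
  have "insert [] ((#) i ` dom (subtree t i)) \<subseteq> dom t"
    using i perm_tree_Nil[of t] t by (auto simp: subtree_def)
  then have "card (insert [] ((#) i ` dom (subtree t i))) \<le> card (dom t)"
    using t card_mono by blast
  moreover have "finite (dom (subtree t i))" using fpt_subtree[OF t] by blast
  ultimately show ?thesis by (simp add: card_insert_if card_image image_iff)
qed

lemma card_dom_subtree_le:
  assumes "fpt t" shows "card (dom (subtree t i)) \<le> card (dom t)"
proof (cases "1 \<le> i \<and> i \<le> arity t")
  case True
  then show ?thesis using card_dom_subtree_less[OF assms] by (simp add: less_imp_le)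
next
  case False
  then show ?thesis
    using card_dom_pos[OF assms] by (simp add: subtree_outside) (simp add: one_node_def)
qed

text \<open>Bisimulation principle, by induction on the word: the root labels settle the empty word,
  and equal arities with the closure of \<open>R\<close> under subtrees settle longer ones. As
  \<open>subtree\<close> is total by padding, closure is asked for every \<open>i\<close> without
  case distinctions on arities.\<close>

lemma fpt_coinduct [consumes 1, case_names fpt1 fpt2 root_label arity subtree]:
  assumes R: "R t u"
    and fpt1: "\<And>t u. R t u \<Longrightarrow> fpt t" and fpt2: "\<And>t u. R t u \<Longrightarrow> fpt u"
    and lab: "\<And>t u. R t u \<Longrightarrow> root_label t = root_label u"
    and ar: "\<And>t u. R t u \<Longrightarrow> arity t = arity u"
    and sub: "\<And>t u i. R t u \<Longrightarrow> R (subtree t i) (subtree u i)"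
  shows "t = u"
proof
  fix w show "t w = u w"
    using R
  proof (induction w arbitrary: t u)
    case Nil
    have "t [] = node (root_label t) (arity t) (subtree t) []"
      using fpt_eq_node[OF fpt1[OF Nil]] by simp
    moreover have "u [] = node (root_label u) (arity u) (subtree u) []"
      using fpt_eq_node[OF fpt2[OF Nil]] by simp
    ultimately show ?case using lab[OF Nil] by simp
  next
    case (Cons i w)
    have "t (i # w) = node (root_label t) (arity t) (subtree t) (i # w)"
      using fpt_eq_node[OF fpt1[OF Cons.prems]] by simp
    moreover have "u (i # w) = node (root_label u) (arity u) (subtree u) (i # w)"
      using fpt_eq_node[OF fpt2[OF Cons.prems]] by simp
    ultimately show ?case
      using ar[OF Cons.prems] Cons.IH[OF sub[OF Cons.prems]] by simp
  qed
qed

section \<open>The inverse monoid\<close>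

lemma permutes_max_comp:
  assumes "\<pi> permutes {1..m::nat}" "\<rho> permutes {1..n}"
  shows "\<pi> \<circ> \<rho> permutes {1..max m n}"
proof (rule permutes_compose)
  show "\<rho> permutes {1..max m n}" by (rule permutes_subset[OF assms(2)]) auto
  show "\<pi> permutes {1..max m n}" by (rule permutes_subset[OF assms(1)]) auto
qed

text \<open>The factors trade places at each level, so neither argument alone serves for the
  induction; the total number of nodes does.\<close>

lemma fpt_mult:
  assumes "fpt t" "fpt u" shows "fpt (pt_mult t u)"
  using assms
proof (induction "card (dom t) + card (dom u)" arbitrary: t u rule: less_induct)
  case less
  show ?case
    unfolding pt_mult_eq_node[of t u]
  proof (rule fpt_node)
    show "root_label t \<circ> root_label u permutes {1..max (arity t) (arity u)}"
      using permutes_max_comp root_label_permutes less.prems by blast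
  next
    fix i assume i: "1 \<le> i" "i \<le> max (arity t) (arity u)"
    show "fpt (if i \<le> arity u then pt_mult (subtree u i) (subtree t (root_label u i)) else subtree t i)"
    proof (cases "i \<le> arity u")
      case True
      \<comment> \<open>Strictness comes from \<open>u\<close> alone: \<open>root_label u i\<close>
        may exceed the arity of \<open>t\<close>, in which case the other subtree is padding and
        only the weak bound is available.\<close>
      have "card (dom (subtree u i)) + card (dom (subtree t (root_label u i)))
        < card (dom t) + card (dom u)"
        using card_dom_subtree_less[OF less.prems(2) i(1) True]
          card_dom_subtree_le[OF less.prems(1), of "root_label u i"] by linarith
      then show ?thesis using less.hyps less.prems fpt_subtree True by simp
    next
      case False
      then show ?thesis using fpt_subtree less.prems by simp
    qed
  qed
qed

lemma root_label_mult: "root_label (pt_mult t u) = root_label t \<circ> root_label u"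
  by (subst pt_mult_eq_node) simp

lemma arity_mult:
  assumes "fpt t" "fpt u" shows "arity (pt_mult t u) = max (arity t) (arity u)"
  by (subst pt_mult_eq_node, rule arity_node) (auto simp: fpt_mult fpt_subtree assms)

lemma subtree_mult_aux:
  assumes "fpt t" "fpt u"
  shows "subtree (pt_mult t u) i =
    (if 1 \<le> i \<and> i \<le> arity u then pt_mult (subtree u i) (subtree t (root_label u i))
     else subtree t i)"
  by (subst pt_mult_eq_node, subst subtree_node)
    (auto simp: fpt_mult fpt_subtree assms subtree_outside)

lemma one_node_mult:
  assumes "fpt t" shows "pt_mult one_node t = t" and "pt_mult t one_node = t"
proof -
  have 2: "pt_mult t one_node = t" if "fpt t" for t
  proof -
    have "pt_mult t one_node = node (root_label t) (arity t) (subtree t)"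
      by (subst pt_mult_eq_node, simp, rule node_cong) simp
    then show ?thesis using fpt_eq_node[OF that] by simp
  qed
  show "pt_mult t one_node = t" by (rule 2[OF assms])
  have "pt_mult one_node t = node (root_label t) (arity t) (subtree t)"
    by (subst pt_mult_eq_node, simp, rule node_cong) (simp add: 2 fpt_subtree assms)
  then show "pt_mult one_node t = t" using fpt_eq_node[OF assms] by simp
qed

lemma root_label_outside:
  assumes "fpt t" "\<not> (1 \<le> i \<and> i \<le> arity t)" shows "root_label t i = i"
  using permutes_not_in[OF root_label_permutes[OF assms(1)]] assms(2) by auto

text \<open>Beyond the arity of \<open>u\<close>, its root label fixes \<open>i\<close> and its
  subtree is the one-node tree, so the right side collapses to \<open>subtree t i\<close> by the
  unit law. This uniform formula is what makes the bisimulation arguments equational.\<close>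

lemma subtree_mult:
  assumes "fpt t" "fpt u"
  shows "subtree (pt_mult t u) i = pt_mult (subtree u i) (subtree t (root_label u i))"
proof (cases "1 \<le> i \<and> i \<le> arity u")
  case True
  then show ?thesis by (simp add: subtree_mult_aux assms)
next
  case False
  then have "subtree (pt_mult t u) i = subtree t i"
    unfolding subtree_mult_aux[OF assms] by (rule if_not_P)
  also have "\<dots> = pt_mult one_node (subtree t i)"
    by (rule one_node_mult(1)[symmetric, OF fpt_subtree[OF assms(1)]])
  also have "\<dots> = pt_mult (subtree u i) (subtree t (root_label u i))"
    by (simp only: subtree_outside[OF False] root_label_outside[OF assms(2) False])
  finally show ?thesis .
qed

lemma pt_mult_assoc:
  assumes "fpt t" "fpt u" "fpt v"
  shows "pt_mult (pt_mult t u) v = pt_mult t (pt_mult u v)"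
proof -
  \<comment> \<open>Descending to a subtree reverses the order of the three factors and hence
    exchanges the two bracketings. The relation therefore contains both orientations of the
    associative law.\<close>
  define R where "R x y \<longleftrightarrow> (\<exists>t u v. fpt t \<and> fpt u \<and> fpt v \<and>
    (x = pt_mult (pt_mult t u) v \<and> y = pt_mult t (pt_mult u v) \<or>
     y = pt_mult (pt_mult t u) v \<and> x = pt_mult t (pt_mult u v)))" for x y
  have RI: "R (pt_mult (pt_mult a b) c) (pt_mult a (pt_mult b c))"
      "R (pt_mult a (pt_mult b c)) (pt_mult (pt_mult a b) c)"
    if "fpt a" "fpt b" "fpt c" for a b c
    unfolding R_def by (rule exI[of _ a], rule exI[of _ b], rule exI[of _ c], use that in simp)+
  from RI(1)[OF assms] show ?thesis
  proof (cases rule: fpt_coinduct)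
    case (subtree x y i)
    then obtain t u v where tuv: "fpt t" "fpt u" "fpt v"
      and xy: "x = pt_mult (pt_mult t u) v \<and> y = pt_mult t (pt_mult u v) \<or>
        y = pt_mult (pt_mult t u) v \<and> x = pt_mult t (pt_mult u v)"
      unfolding R_def by blast
    let ?v = "subtree v i" and ?u = "subtree u (root_label v i)"
      and ?t = "subtree t (root_label u (root_label v i))"
    have "subtree (pt_mult (pt_mult t u) v) i = pt_mult ?v (pt_mult ?u ?t)"
      and "subtree (pt_mult t (pt_mult u v)) i = pt_mult (pt_mult ?v ?u) ?t"
      using tuv by (simp_all add: subtree_mult fpt_mult root_label_mult)
    moreover note RI[OF tuv(3,2,1)[THEN fpt_subtree], of i "root_label v i"
        "root_label u (root_label v i)"]
    ultimately show ?case using xy by (elim disjE conjE) simp_all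
  next
    case (fpt1 x y)
    then show ?case unfolding R_def by (elim exE conjE disjE) (simp_all add: fpt_mult)
  next
    case (fpt2 x y)
    then show ?case unfolding R_def by (elim exE conjE disjE) (simp_all add: fpt_mult)
  next
    case (root_label x y)
    then show ?case unfolding R_def by (elim exE conjE disjE) (simp_all add: root_label_mult comp_assoc)
  next
    case (arity x y)
    then show ?case unfolding R_def
      by (elim exE conjE disjE) (simp_all add: arity_mult fpt_mult max.assoc)
  qed
qed

section \<open>The involution\<close>

lemma bij_root_label: "fpt t \<Longrightarrow> bij (root_label t)"
  using root_label_permutes permutes_bij by blast

lemma root_label_inv [simp]:
  assumes "fpt t"
  shows "root_label t (inv_into UNIV (root_label t) i) = i"
    and "inv_into UNIV (root_label t) (root_label t i) = i"
  using bij_root_label[OF assms] by (simp_all add: bij_is_surj surj_f_inv_f bij_is_inj)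

lemma inv_root_label_permutes: "fpt t \<Longrightarrow> inv_into UNIV (root_label t) permutes {1..arity t}"
  using root_label_permutes permutes_inv by blast

lemma fpt_star:
  assumes "fpt t" shows "fpt (pt_star t)"
  using assms
proof (induction "card (dom t)" arbitrary: t rule: less_induct)
  case less
  show ?case
    unfolding pt_star_eq_node[of t]
  proof (rule fpt_node)
    show p: "inv_into UNIV (root_label t) permutes {1..arity t}"
      using inv_root_label_permutes less.prems by blast
    fix i assume "1 \<le> i" "i \<le> arity t"
    \<comment> \<open>The inverse label permutes \<open>{1..arity t}\<close>, so the index names a
      genuine child and the domain shrinks strictly.\<close>
    then have "1 \<le> inv_into UNIV (root_label t) i" "inv_into UNIV (root_label t) i \<le> arity t"
      using permutes_in_image[OF p, of i] by auto
    then show "fpt (pt_star (subtree t (inv_into UNIV (root_label t) i)))"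
      using less.hyps less.prems card_dom_subtree_less fpt_subtree by simp
  qed
qed

lemma root_label_star: "root_label (pt_star t) = inv_into UNIV (root_label t)"
  by (subst pt_star_eq_node) simp

lemma arity_star:
  assumes "fpt t" shows "arity (pt_star t) = arity t"
  by (subst pt_star_eq_node, rule arity_node) (auto simp: fpt_star fpt_subtree assms)

lemma star_one_node: "pt_star one_node = one_node"
  by (subst pt_star_eq_node) (simp add: one_node_eq_node[symmetric])

text \<open>Beyond the arity, the inverse label fixes \<open>i\<close> and both sides are the
  one-node tree, which is its own star.\<close>

lemma subtree_star:
  assumes "fpt t" shows "subtree (pt_star t) i = pt_star (subtree t (inv_into UNIV (root_label t) i))"
proof (cases "1 \<le> i \<and> i \<le> arity t")
  case True
  then show ?thesis
    by (subst pt_star_eq_node, subst subtree_node) (auto simp: fpt_star fpt_subtree assms)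
next
  case False
  then have "inv_into UNIV (root_label t) i = i"
    using permutes_not_in[OF inv_root_label_permutes[OF assms]] by auto
  then show ?thesis using False by (simp add: subtree_outside arity_star assms star_one_node)
qed

text \<open>With three factors of the shape \<open>y y* y\<close>, reversal is harmless: up to
  associativity, the subtree at \<open>i\<close> is the same expression in \<open>y_i\<close>,
  because the root labels of \<open>y\<close> and \<open>y*\<close> cancel.\<close>

lemma mult_star_mult:
  assumes "fpt t" shows "pt_mult (pt_mult t (pt_star t)) t = t"
proof -
  define R where "R x y \<longleftrightarrow> fpt y \<and> x = pt_mult (pt_mult y (pt_star y)) y" for x y
  have "R (pt_mult (pt_mult t (pt_star t)) t) t" using assms by (simp add: R_def)
  then show ?thesis
  proof (cases rule: fpt_coinduct)
    case (root_label x y)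
    then show ?case
      by (intro ext) (simp add: R_def root_label_mult root_label_star)
  next
    case (subtree x y i)
    then show ?case
      by (simp add: R_def root_label_mult root_label_star subtree_mult subtree_star fpt_mult
        fpt_star fpt_subtree pt_mult_assoc)
  qed (auto simp: R_def fpt_mult fpt_star arity_mult arity_star)
qed

lemma star_mult_star:
  assumes "fpt t" shows "pt_mult (pt_mult (pt_star t) t) (pt_star t) = pt_star t"
proof -
  \<comment> \<open>The tree \<open>t\<close> is carried along as a witness: the subtree at
    \<open>i\<close> is governed by \<open>t_j\<close> with \<open>j\<close> the preimage of
    \<open>i\<close> under the root label of \<open>t\<close>.\<close>
  define R where "R x y \<longleftrightarrow> (\<exists>t. fpt t \<and> y = pt_star t \<and>
    x = pt_mult (pt_mult (pt_star t) t) (pt_star t))" for x y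
  have "R (pt_mult (pt_mult (pt_star t) t) (pt_star t)) (pt_star t)"
    unfolding R_def using assms by blast
  then show ?thesis
  proof (cases rule: fpt_coinduct)
    case (root_label x y)
    then obtain t where "fpt t" "y = pt_star t"
      "x = pt_mult (pt_mult (pt_star t) t) (pt_star t)" by (auto simp: R_def)
    then show ?case by (intro ext) (simp add: root_label_mult root_label_star)
  next
    case (subtree x y i)
    then obtain t where t: "fpt t" "y = pt_star t"
      "x = pt_mult (pt_mult (pt_star t) t) (pt_star t)" by (auto simp: R_def)
    let ?s = "subtree t (inv_into UNIV (root_label t) i)"
    have "subtree x i = pt_mult (pt_mult (pt_star ?s) ?s) (pt_star ?s)"
      using t by (simp add: root_label_mult root_label_star subtree_mult subtree_star fpt_mult fpt_star
        fpt_subtree pt_mult_assoc)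
    then show ?case using t fpt_subtree by (auto simp: R_def subtree_star)
  qed (auto simp: R_def fpt_mult fpt_star arity_mult arity_star)
qed

text \<open>The two equations for mutual inverses descend: if \<open>j\<close> is the preimage of
  \<open>i\<close> under the root label of \<open>t\<close>, then \<open>t_j\<close> and
  \<open>u_i\<close> are mutually inverse again. Labels and arities are forced at each
  level.\<close>

lemma pt_star_unique:
  assumes "fpt t" "fpt u" "pt_mult (pt_mult t u) t = t" "pt_mult (pt_mult u t) u = u"
  shows "u = pt_star t"
proof -
  define R where "R u s \<longleftrightarrow> (\<exists>t. fpt t \<and> fpt u \<and> s = pt_star t \<and>
    pt_mult (pt_mult t u) t = t \<and> pt_mult (pt_mult u t) u = u)" for u s
  have label: "root_label u = inv_into UNIV (root_label t)"
    if "fpt t" "pt_mult (pt_mult t u) t = t" for t u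
  proof -
    have "root_label t (root_label u (root_label t i)) = root_label t i" for i
      using that(2) root_label_mult by (metis comp_apply)
    \<comment> \<open>From \<pi>\<rho>\<pi> = \<pi>, the injective \<pi> is cancelled on the left;
      its bijectivity then identifies \<rho> with the inverse.\<close>
    then have "root_label u (root_label t i) = i" for i
      using bij_root_label[OF that(1)] by (meson bij_is_inj injD)
    then show ?thesis
      using bij_root_label[OF that(1)] by (metis bij_inv_eq_iff ext)
  qed
  have "R u (pt_star t)" unfolding R_def using assms by (intro exI[of _ t] conjI) simp_all
  then show ?thesis
  proof (cases rule: fpt_coinduct)
    case (root_label u s)
    then obtain t where "fpt t" "s = pt_star t" "pt_mult (pt_mult t u) t = t"
      unfolding R_def by iprover
    then show ?case using label by (simp only: root_label_star)
  next
    case (arity u s)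
    then obtain t where t: "fpt t" "fpt u" "s = pt_star t"
      "pt_mult (pt_mult t u) t = t" "pt_mult (pt_mult u t) u = u"
      unfolding R_def by iprover
    have "arity (pt_mult (pt_mult t u) t) = max (max (arity t) (arity u)) (arity t)"
      and "arity (pt_mult (pt_mult u t) u) = max (max (arity u) (arity t)) (arity u)"
      using t(1,2) by (simp_all add: arity_mult fpt_mult)
    \<comment> \<open>Rewriting the products by the hypotheses makes each arity a maximum that
      includes the other, so each bounds the other.\<close>
    then have "arity u = arity t" unfolding t(4,5) by linarith
    then show ?case using t(1,3) by (simp add: arity_star)
  next
    case (subtree u s i)
    then obtain t where t: "fpt t" "fpt u" "s = pt_star t"
      "pt_mult (pt_mult t u) t = t" "pt_mult (pt_mult u t) u = u"
      unfolding R_def by iprover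
    define j where "j = inv_into UNIV (root_label t) i"
    have j: "root_label t j = i" "root_label u i = j"
      using t(1) label[OF t(1,4)] by (simp_all add: j_def)
    have "subtree (pt_mult (pt_mult t u) t) j =
        pt_mult (pt_mult (subtree t j) (subtree u i)) (subtree t j)"
      and "subtree (pt_mult (pt_mult u t) u) i =
        pt_mult (pt_mult (subtree u i) (subtree t j)) (subtree u i)"
      using t(1,2) j by (simp_all add: root_label_mult subtree_mult fpt_mult fpt_subtree pt_mult_assoc)
    \<comment> \<open>The hypotheses replace the products on the left by \<open>t\<close> and
      \<open>u\<close>, leaving exactly the two inverse equations for \<open>subtree t j\<close> and
      \<open>subtree u i\<close>.\<close>
    note this[unfolded t(4,5), symmetric]
    moreover have "subtree s i = pt_star (subtree t j)"
      unfolding t(3) j_def by (rule subtree_star[OF t(1)])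
    ultimately show ?case
      unfolding R_def using fpt_subtree[OF t(1), of j] fpt_subtree[OF t(2), of i]
      by (intro exI[of _ "subtree t j"] conjI) simp_all
  next
    case (fpt1 u s)
    then show ?case unfolding R_def by (elim exE conjE) (rule conjI)
  next
    case (fpt2 u s)
    then show ?case unfolding R_def by (elim exE conjE) (simp only: fpt_star)
  qed
qed

lemma monoid_FPT: "monoid FPT"
  by (rule monoidI) (auto simp: FPT_def fpt_mult fpt_one_node one_node_mult pt_mult_assoc)

lemma inverse_monoid_FPT: "inverse_monoid FPT pt_star"
  unfolding inverse_monoid_def
  using monoid_FPT fpt_star mult_star_mult star_mult_star pt_star_unique
  by (auto simp: FPT_def)

section \<open>Residual finiteness\<close>

lemma finite_quotient_monoid:
  fixes \<alpha> :: "'a \<Rightarrow> nat"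
  assumes "monoid M" and fin: "finite (\<alpha> ` carrier M)"
    and cong: "\<And>x x' y y'. \<lbrakk>x \<in> carrier M; x' \<in> carrier M; y \<in> carrier M; y' \<in> carrier M;
      \<alpha> x = \<alpha> x'; \<alpha> y = \<alpha> y'\<rbrakk> \<Longrightarrow> \<alpha> (x \<otimes>\<^bsub>M\<^esub> y) = \<alpha> (x' \<otimes>\<^bsub>M\<^esub> y')"
  shows "\<exists>N :: nat monoid. monoid N \<and> finite (carrier N) \<and> \<alpha> \<in> monoid_hom M N"
proof -
  interpret M: monoid M by fact
  let ?r = "inv_into (carrier M) \<alpha>"
  \<comment> \<open>The image of \<open>\<alpha>\<close> carries the quotient structure, multiplied
    through preimages chosen by \<open>?r\<close>; the congruence hypothesis makes the result
    independent of the choice.\<close>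
  define N where "N = \<lparr>carrier = \<alpha> ` carrier M,
    monoid.mult = (\<lambda>a b. \<alpha> (?r a \<otimes>\<^bsub>M\<^esub> ?r b)), one = \<alpha> \<one>\<^bsub>M\<^esub>\<rparr>"
  have mult: "\<alpha> x \<otimes>\<^bsub>N\<^esub> \<alpha> y = \<alpha> (x \<otimes>\<^bsub>M\<^esub> y)" if "x \<in> carrier M" "y \<in> carrier M" for x y
    using that cong[of "?r (\<alpha> x)" x "?r (\<alpha> y)" y]
    by (simp add: N_def inv_into_into f_inv_into_f)
  have carr: "carrier N = \<alpha> ` carrier M" and one: "\<one>\<^bsub>N\<^esub> = \<alpha> \<one>\<^bsub>M\<^esub>"
    by (simp_all add: N_def)
  have "monoid N"
    by (rule monoidI) (auto simp: carr one mult M.m_assoc)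
  moreover have "\<alpha> \<in> monoid_hom M N"
    by (auto simp: monoid_hom_def hom_def carr one mult)
  ultimately show ?thesis using fin carr by auto
qed

text \<open>By hypothesis the elements outside \<open>A\<close> form an ideal. Collapsing it to a
  single zero leaves a finite monoid in which distinct elements of \<open>A\<close> stay
  distinct.\<close>

lemma rees_quotient_separates:
  assumes M: "monoid M" and "finite A"
    and ideal: "\<And>x y. \<lbrakk>x \<in> carrier M; y \<in> carrier M; x \<otimes>\<^bsub>M\<^esub> y \<in> A\<rbrakk> \<Longrightarrow> x \<in> A \<and> y \<in> A"
    and uv: "u \<in> A" "v \<in> A" "u \<noteq> v"
  shows "\<exists>(N :: nat monoid) \<alpha>. monoid N \<and> finite (carrier N) \<and> \<alpha> \<in> monoid_hom M N \<and> \<alpha> u \<noteq> \<alpha> v"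
proof -
  have inj: "inj_on (to_nat_on A) A"
    using \<open>finite A\<close> by (simp add: countable_finite inj_on_to_nat_on)
  \<comment> \<open>The successor keeps 0 free as the image of the collapsed ideal, while the
    numbering is injective on \<open>A\<close>.\<close>
  define \<alpha> where "\<alpha> x = (if x \<in> A then Suc (to_nat_on A x) else 0)" for x
  have eq: "x = x' \<or> x \<notin> A \<and> x' \<notin> A" if "\<alpha> x = \<alpha> x'" for x x'
  proof (cases "x \<in> A \<and> x' \<in> A")
    case True
    then have "to_nat_on A x = to_nat_on A x'" using that by (simp add: \<alpha>_def)
    then show ?thesis using inj_onD[OF inj] True by blast
  next
    case False
    then show ?thesis using that by (cases "x \<in> A"; cases "x' \<in> A") (simp_all add: \<alpha>_def)
  qed
  have "\<alpha> ` carrier M \<subseteq> insert 0 ((\<lambda>x. Suc (to_nat_on A x)) ` A)"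
    by (auto simp: \<alpha>_def)
  then have "finite (\<alpha> ` carrier M)" using \<open>finite A\<close> by (auto intro: finite_subset)
  moreover have "\<alpha> (x \<otimes>\<^bsub>M\<^esub> y) = \<alpha> (x' \<otimes>\<^bsub>M\<^esub> y')"
    if "x \<in> carrier M" "x' \<in> carrier M" "y \<in> carrier M" "y' \<in> carrier M"
      "\<alpha> x = \<alpha> x'" "\<alpha> y = \<alpha> y'" for x x' y y'
  \<comment> \<open>If both factors lie in \<open>A\<close>, equal images mean equal elements.
    Otherwise each product has a factor in the ideal, so both products are sent to 0.\<close>
  proof (cases "x \<in> A \<and> y \<in> A")
    case True
    then show ?thesis using eq that by blast
  next
    case False
    then have "\<not> (x' \<in> A \<and> y' \<in> A)" using eq that by blast
    then show ?thesis using False ideal that by (auto simp: \<alpha>_def)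
  qed
  ultimately obtain N :: "nat monoid" where "monoid N" "finite (carrier N)" "\<alpha> \<in> monoid_hom M N"
    using finite_quotient_monoid[OF M] by blast
  moreover have "\<alpha> u \<noteq> \<alpha> v" using eq uv by blast
  ultimately show ?thesis by blast
qed

section \<open>Trees of bounded depth and arity, and the ideal of the remaining ones\<close>

definition box :: "nat \<Rightarrow> nat \<Rightarrow> nat list set" where
  "box k n = {w. set w \<subseteq> {..n} \<and> length w \<le> k}"

lemma finite_box: "finite (box k n)"
  by (simp add: box_def finite_lists_length_le)

lemma Cons_in_box [simp]: "i # w \<in> box (Suc k) n \<longleftrightarrow> i \<le> n \<and> w \<in> box k n"
  by (auto simp: box_def)

text \<open>Passing to a subtree lowers the depth bound by one and keeps the letter bound, hence two
  separate parameters. Quantifying over all \<open>i\<close> is harmless since padding fits into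
  every box, and it matches the form of \<open>subtree_mult\<close>.\<close>

lemma dom_subset_box_iff:
  assumes "fpt t"
  shows "dom t \<subseteq> box (Suc k) n \<longleftrightarrow> arity t \<le> n \<and> (\<forall>i. dom (subtree t i) \<subseteq> box k n)"
proof -
  have d: "dom t = insert [] (\<Union>i\<in>{1..arity t}. (#) i ` dom (subtree t i))"
    using fpt_eq_node[OF assms] dom_node by metis
  have Nil: "[] \<in> box k n" for k by (simp add: box_def)
  have one: "dom one_node \<subseteq> box k n" by (simp add: one_node_def Nil)
  show ?thesis
  proof
    assume L: "dom t \<subseteq> box (Suc k) n"
    have "arity t \<le> n"
    proof (cases "arity t = 0")
      case False
      \<comment> \<open>The last child of the root carries the largest letter, which the box bounds
        by \<open>n\<close>.\<close>
      then have "[arity t] \<in> dom t" using arity_iff[OF assms] by simp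
      then show ?thesis using L by auto
    qed simp
    moreover have "dom (subtree t i) \<subseteq> box k n" for i
    proof (cases "1 \<le> i \<and> i \<le> arity t")
      case True
      then show ?thesis using L unfolding d by force
    next
      case False
      then show ?thesis using one by (simp add: subtree_outside)
    qed
    ultimately show "arity t \<le> n \<and> (\<forall>i. dom (subtree t i) \<subseteq> box k n)" by blast
  next
    assume R: "arity t \<le> n \<and> (\<forall>i. dom (subtree t i) \<subseteq> box k n)"
    then show "dom t \<subseteq> box (Suc k) n" unfolding d using Nil by fastforce
  qed
qed

lemma dom_subset_box_0_iff:
  assumes "fpt t" shows "dom t \<subseteq> box 0 n \<longleftrightarrow> arity t = 0"
proof -
  have d: "dom t = insert [] (\<Union>i\<in>{1..arity t}. (#) i ` dom (subtree t i))"
    using fpt_eq_node[OF assms] dom_node by metis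
  have "arity t = 0" if "dom t \<subseteq> box 0 n"
    using that arity_iff[OF assms, of "arity t"] by (force simp: box_def)
  moreover have "dom t \<subseteq> box 0 n" if "arity t = 0"
    unfolding d using that by (simp add: box_def)
  ultimately show ?thesis by blast
qed

text \<open>Read contrapositively: a product with a factor that leaves the box leaves it too, so
  such trees form an ideal. The induction is on depth, with both factors general because they are
  exchanged at each level.\<close>

lemma dom_mult_subset_box:
  assumes "fpt t" "fpt u" "dom (pt_mult t u) \<subseteq> box k n"
  shows "dom t \<subseteq> box k n \<and> dom u \<subseteq> box k n"
  using assms
proof (induction k arbitrary: t u)
  case 0
  then show ?case by (simp add: dom_subset_box_0_iff fpt_mult arity_mult)
next
  case (Suc k)
  then have ar: "arity t \<le> n" "arity u \<le> n"
    and "\<And>i. dom (pt_mult (subtree u i) (subtree t (root_label u i))) \<subseteq> box k n"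
    by (simp_all add: dom_subset_box_iff fpt_mult arity_mult subtree_mult)
  then have sub: "dom (subtree u i) \<subseteq> box k n" "dom (subtree t (root_label u i)) \<subseteq> box k n" for i
    using Suc.IH Suc.prems fpt_subtree by blast+
  \<comment> \<open>The induction hypothesis reaches only subtrees of \<open>t\<close> at indices
    \<open>root_label u i\<close>; surjectivity of the label makes these all of them.\<close>
  have "dom (subtree t i) \<subseteq> box k n" for i
    using sub(2) bij_root_label[OF Suc.prems(2)] by (metis bij_pointE)
  then show ?case using Suc.prems ar sub(1) by (simp add: dom_subset_box_iff)
qed

text \<open>A finite box has finitely many subsets as possible domains, and bounded arities confine
  all labels to the finite group \<open>S_n\<close>.\<close>

lemma finite_fpt_subset_box: "finite {t. fpt t \<and> dom t \<subseteq> box k n}"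
proof -
  let ?B = "{\<pi>. \<pi> permutes {1..n}}"
  define F where "F = {t. dom t \<subseteq> box (Suc k) n \<and> ran t \<subseteq> ?B}"
  \<comment> \<open>Sorting by domain reduces the count to maps from a fixed finite domain into a
    finite set.\<close>
  have "F \<subseteq> (\<Union>D\<in>Pow (box (Suc k) n). {t. dom t = D \<and> ran t \<subseteq> ?B})"
    by (auto simp: F_def)
  moreover have "finite {t. dom t = D \<and> ran t \<subseteq> ?B}" if "D \<in> Pow (box (Suc k) n)" for D
    using that finite_set_of_finite_maps[of D ?B] finite_box finite_permutations[of "{1..n}"]
    by (metis PowD finite_atLeastAtMost finite_subset)
  ultimately have "finite F" using finite_box[of "Suc k" n] by (auto intro: finite_subset)
  moreover have "{t. fpt t \<and> dom t \<subseteq> box k n} \<subseteq> F"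
  proof
    fix t assume "t \<in> {t. fpt t \<and> dom t \<subseteq> box k n}"
    then have t: "fpt t" and d: "dom t \<subseteq> box k n" by auto
    have "\<pi> permutes {1..n}" if "t w = Some \<pi>" for w \<pi>
    proof -
      \<comment> \<open>The box bounds the letters, and since the children form an initial segment
        this also bounds their number, so the label permutes \<open>{1..n}\<close>.\<close>
      have "child_set t w \<subseteq> {..n}" using d by (force simp: child_set_def box_def)
      then have "{1..card (child_set t w)} \<subseteq> {1..n}"
        using fpt_child_set(1)[OF t, of w] by (metis atLeastAtMost_iff atMost_iff subset_iff)
      moreover have "\<pi> permutes {1..card (child_set t w)}"
        using t that fpt_child_set(2)[OF t, of w] unfolding perm_tree_def by blast
      ultimately show ?thesis using permutes_subset by blast
    qed
    moreover have "box k n \<subseteq> box (Suc k) n" by (auto simp: box_def)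
    ultimately show "t \<in> F" using d by (auto simp: F_def ran_def)
  qed
  ultimately show ?thesis by (rule rev_finite_subset)
qed

lemma finite_subset_box:
  assumes "finite A" shows "\<exists>n. A \<subseteq> box n n"
proof -
  have "finite (length ` A \<union> \<Union> (set ` A))" using assms by auto
  then obtain n where n: "length ` A \<union> \<Union> (set ` A) \<subseteq> {..n}"
    using finite_nat_iff_bounded_le by blast
  have "w \<in> box n n" if "w \<in> A" for w
  proof -
    have "length w \<in> {..n}" "set w \<subseteq> {..n}" using n that by blast+
    then show ?thesis by (simp add: box_def)
  qed
  then show ?thesis by blast
qed

lemma residually_finite_FPT: "residually_finite FPT"
  unfolding residually_finite_def
proof (intro ballI impI)
  fix u v assume uv: "u \<in> carrier FPT" "v \<in> carrier FPT" "u \<noteq> v"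
  then have "finite (dom u \<union> dom v)" by (auto simp: FPT_def)
  then obtain n where n: "dom u \<union> dom v \<subseteq> box n n" using finite_subset_box by blast
  show "\<exists>(N :: nat monoid) \<alpha>. monoid N \<and> finite (carrier N) \<and>
    \<alpha> \<in> monoid_hom FPT N \<and> \<alpha> u \<noteq> \<alpha> v"
  proof (rule rees_quotient_separates[OF monoid_FPT])
    \<comment> \<open>This fixes the set \<open>A\<close> of the Rees quotient: the trees that fit
      into a box containing both \<open>u\<close> and \<open>v\<close>.\<close>
    show "finite {t. fpt t \<and> dom t \<subseteq> box n n}" by (rule finite_fpt_subset_box)
  qed (use uv n dom_mult_subset_box in \<open>auto simp: FPT_def\<close>)
qed

theorem theorem3p18:
  shows "inverse_monoid FPT pt_star \<and> residually_finite FPT"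
  using inverse_monoid_FPT residually_finite_FPT by blast

end
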